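(* For any positive integers $n$ and $r$ with $r\leq n$, there exists an $n$-vertex directed graph with a source $s$, a sink $t$, and $(s,t)$-max-flow value $2r$, such that any dual fault-tolerant min-cut oracle for this graph requires $\Omega(nr)$ bits.
   Context: Graphs are directed unweighted with unit edge capacities. A dual fault-tolerant min-cut oracle for a graph $G$ is a data structure that, given any set $F$ of two edges of $G$, reports the size of an $(s,t)$-min-cut in $G-F$ (the graph with the edges of $F$ deleted).
   Formalization: The case n = 1 is excluded (no distinct source and sink), parallel edges are allowed (needed when r is close to n), and the oracle's query procedure is fixed before the graph is chosen, since for one fixed graph the answers could be built into the procedure at 0 bits. *)

theory Defs
  imports Complex_Main "Graph_Theory.Digraph"
begin

text \<open>
  Parallel edges are allowed: a max-flow value \<open>2 r\<close> with \<open>r\<close> as large as the number of vertices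
  is impossible in a simple graph. An edge \<open>(u, v, k)\<close> goes from \<open>u\<close> to \<open>v\<close>; the index \<open>k\<close> only
  separates parallel edges. So the name of an edge already reveals its endpoints, and the vertices
  are always \<open>0, \<dots>, n - 1\<close>: an oracle does not have to spend bits on decoding arbitrary names.
\<close>

type_synonym edge = "nat \<times> nat \<times> nat"

definition n_vertex_digraph :: "nat \<Rightarrow> (nat, edge) pre_digraph \<Rightarrow> bool" where
  "n_vertex_digraph n G \<longleftrightarrow>
     fin_digraph G \<and> verts G = {..<n} \<and>
     (\<forall>u v k. tail G (u, v, k) = u \<and> head G (u, v, k) = v)"

definition delete_arcs :: "('a, 'b) pre_digraph \<Rightarrow> 'b set \<Rightarrow> ('a, 'b) pre_digraph" where
  "delete_arcs G F = G\<lparr>arcs := arcs G - F\<rparr>"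


definition is_flow :: "('a, 'b) pre_digraph \<Rightarrow> 'a \<Rightarrow> 'a \<Rightarrow> ('b \<Rightarrow> real) \<Rightarrow> bool" where
  "is_flow G s t f \<longleftrightarrow>
     (\<forall>e \<in> arcs G. 0 \<le> f e \<and> f e \<le> 1) \<and>
     (\<forall>v \<in> verts G - {s, t}. sum f (in_arcs G v) = sum f (out_arcs G v))"

definition flow_value :: "('a, 'b) pre_digraph \<Rightarrow> 'a \<Rightarrow> ('b \<Rightarrow> real) \<Rightarrow> real" where
  "flow_value G s f = sum f (out_arcs G s) - sum f (in_arcs G s)"

definition is_max_flow :: "('a, 'b) pre_digraph \<Rightarrow> 'a \<Rightarrow> 'a \<Rightarrow> ('b \<Rightarrow> real) \<Rightarrow> bool" where
  "is_max_flow G s t f \<longleftrightarrow>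
     is_flow G s t f \<and> (\<forall>g. is_flow G s t g \<longrightarrow> flow_value G s g \<le> flow_value G s f)"

definition has_max_flow_value :: "('a, 'b) pre_digraph \<Rightarrow> 'a \<Rightarrow> 'a \<Rightarrow> real \<Rightarrow> bool" where
  "has_max_flow_value G s t x \<longleftrightarrow> (\<exists>f. is_max_flow G s t f \<and> flow_value G s f = x)"


definition st_cuts :: "('a, 'b) pre_digraph \<Rightarrow> 'a \<Rightarrow> 'a \<Rightarrow> 'a set set" where
  "st_cuts G s t = {S. S \<subseteq> verts G \<and> s \<in> S \<and> t \<notin> S}"

definition cut_size :: "('a, 'b) pre_digraph \<Rightarrow> 'a set \<Rightarrow> nat" where
  "cut_size G S = card {e \<in> arcs G. tail G e \<in> S \<and> head G e \<notin> S}"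

definition min_cut_size :: "('a, 'b) pre_digraph \<Rightarrow> 'a \<Rightarrow> 'a \<Rightarrow> nat" where
  "min_cut_size G s t = Min (cut_size G ` st_cuts G s t)"


text \<open>
  A data structure is a bit string \<open>D\<close> together with an arbitrary procedure \<open>query\<close> that answers
  from \<open>D\<close> and the failed edges alone; it is an oracle for \<open>G\<close> if all answers are right. Space is the
  length of \<open>D\<close>. A lower bound only makes sense if \<open>query\<close> is fixed before the graph is chosen, since
  otherwise \<open>query\<close> could have all answers for one graph built in.
\<close>

definition dual_ft_min_cut_oracle ::
  "(bool list \<Rightarrow> 'b set \<Rightarrow> nat) \<Rightarrow> bool list \<Rightarrow> ('a, 'b) pre_digraph \<Rightarrow> 'a \<Rightarrow> 'a \<Rightarrow> bool" where
  "dual_ft_min_cut_oracle query D G s t \<longleftrightarrow>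
     (\<forall>F. F \<subseteq> arcs G \<and> card F = 2 \<longrightarrow> query D F = min_cut_size (delete_arcs G F) s t)"

end

theory Submission
  imports Defs "Graph_Theory.Euler"
begin

text \<open>
  Take \<open>2 p\<close> vertex-disjoint chains from \<open>s\<close> to \<open>t\<close>, each with \<open>L\<close> inner vertices, where the first
  \<open>p\<close> chains are called left and the others right. For every left chain \<open>c\<close>, right chain \<open>d\<close> and
  level \<open>k\<close>, one bit decides whether there is a cross arc from the \<open>k\<close>-th vertex of \<open>c\<close> to the
  \<open>k\<close>-th vertex of \<open>d\<close>. If the arc of \<open>c\<close> leaving level \<open>k\<close> and the arc of \<open>d\<close> entering level \<open>k\<close>
  fail, then the flow on \<open>c\<close> can only be diverted to \<open>t\<close> along a cross arc from \<open>c\<close> to \<open>d\<close> at a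
  level that is at most \<open>k\<close> and at least \<open>k\<close>: with this arc, \<open>2 r - 1\<close> arc-disjoint trails survive,
  and without it there is a cut of size \<open>2 r - 2\<close>. Hence the two failures reveal the bit \<open>(c, d, k)\<close>,
  and an oracle has to store all \<open>p\<^sup>2 L\<close> bits. With \<open>p L\<close> of order \<open>n\<close>, with \<open>p\<close> of order \<open>r\<close>, and
  with direct arcs from \<open>s\<close> to \<open>t\<close> making up for the difference of \<open>p\<close> and \<open>r\<close>, this is of order \<open>n r\<close>.
\<close>

section \<open>Flows and cuts\<close>

definition cut_arcs :: "('a, 'b) pre_digraph \<Rightarrow> 'a set \<Rightarrow> 'b set" where
  "cut_arcs G S = {e \<in> arcs G. tail G e \<in> S \<and> head G e \<notin> S}"

lemma cut_size_eq_card_cut_arcs: "cut_size G S = card (cut_arcs G S)"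
  by (simp add: cut_size_def cut_arcs_def)

lemma delete_arcs_simps [simp]:
  "verts (delete_arcs G F) = verts G"
  "arcs (delete_arcs G F) = arcs G - F"
  "tail (delete_arcs G F) = tail G"
  "head (delete_arcs G F) = head G"
  by (simp_all add: delete_arcs_def)

lemma st_cuts_delete_arcs [simp]: "st_cuts (delete_arcs G F) = st_cuts G"
  by (simp add: st_cuts_def fun_eq_iff)

lemma cut_arcs_delete_arcs: "cut_arcs (delete_arcs G F) S = cut_arcs G S - F"
  by (auto simp: cut_arcs_def)

lemma trail_delete_arcs_iff:
  "pre_digraph.trail (delete_arcs G F) u p v \<longleftrightarrow> pre_digraph.trail G u p v \<and> set p \<inter> F = {}"
proof -
  have "pre_digraph.cas (delete_arcs G F) = pre_digraph.cas G"
    by (rule compatible_cas) (simp add: compatible_def)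
  then show ?thesis
    by (auto simp: pre_digraph.trail_def pre_digraph.awalk_def)
qed

lemma (in wf_digraph) awalk_map_upt:
  assumes "i \<le> j" "u i \<in> verts G"
    and "\<And>l. i \<le> l \<Longrightarrow> l < j \<Longrightarrow> a l \<in> arcs G"
    and "\<And>l. i \<le> l \<Longrightarrow> l < j \<Longrightarrow> tail G (a l) = u l"
    and "\<And>l. i \<le> l \<Longrightarrow> l < j \<Longrightarrow> head G (a l) = u (Suc l)"
  shows "awalk (u i) (map a [i..<j]) (u j)"
  using assms
proof (induction j rule: dec_induct)
  case base
  then show ?case by (simp add: awalk_Nil_iff)
next
  case (step j)
  then have "awalk (u j) [a j] (u (Suc j))"
    using arc_implies_awalk[of "a j"] by simp
  moreover have "awalk (u i) (map a [i..<j]) (u j)"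
    using step by simp
  ultimately show ?case
    using step.hyps awalk_appendI by simp
qed

definition (in pre_digraph) arc_disjoint_trails :: "'a \<Rightarrow> 'i set \<Rightarrow> ('i \<Rightarrow> 'b list) \<Rightarrow> 'a \<Rightarrow> bool" where
  "arc_disjoint_trails s I P t \<longleftrightarrow>
     finite I \<and> (\<forall>i\<in>I. trail s (P i) t) \<and> disjoint_family_on (\<lambda>i. set (P i)) I"

context fin_digraph
begin

lemma fin_digraph_delete_arcs: "fin_digraph (delete_arcs G F)"
  by unfold_locales auto

lemma finite_st_cuts: "finite (st_cuts G s t)"
  by (auto simp: st_cuts_def intro: finite_subset[of _ "Pow (verts G)"])

lemma min_cut_size_le: "S \<in> st_cuts G s t \<Longrightarrow> min_cut_size G s t \<le> cut_size G S"
  unfolding min_cut_size_def by (simp add: finite_st_cuts)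

lemma min_cut_size_ge:
  assumes "s \<in> verts G" "s \<noteq> t" and "\<And>S. S \<in> st_cuts G s t \<Longrightarrow> m \<le> cut_size G S"
  shows "m \<le> min_cut_size G s t"
proof -
  have "{s} \<in> st_cuts G s t"
    using assms by (simp add: st_cuts_def)
  then show ?thesis
    unfolding min_cut_size_def using assms by (subst Min_ge_iff) (auto simp: finite_st_cuts)
qed

lemma flow_value_eq_net_cut_flow:
  assumes flow: "is_flow G s t f" and cut: "S \<in> st_cuts G s t"
  shows "flow_value G s f = sum f (cut_arcs G S) - sum f (cut_arcs G (- S))"
proof -
  have S: "S \<subseteq> verts G" "s \<in> S" "t \<notin> S" and "finite S"
    using cut by (auto simp: st_cuts_def intro: finite_subset)
  define inner where "inner = {e \<in> arcs G. tail G e \<in> S \<and> head G e \<in> S}"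
  have "(\<Union>v\<in>S. out_arcs G v) = cut_arcs G S \<union> inner"
    and "(\<Union>v\<in>S. in_arcs G v) = cut_arcs G (- S) \<union> inner"
    by (auto simp: cut_arcs_def inner_def)
  moreover have "sum f (\<Union>v\<in>S. out_arcs G v) = (\<Sum>v\<in>S. sum f (out_arcs G v))"
    and "sum f (\<Union>v\<in>S. in_arcs G v) = (\<Sum>v\<in>S. sum f (in_arcs G v))"
    using \<open>finite S\<close> by (intro sum.UNION_disjoint; auto)+
  moreover have "sum f (cut_arcs G S \<union> inner) = sum f (cut_arcs G S) + sum f inner"
    and "sum f (cut_arcs G (- S) \<union> inner) = sum f (cut_arcs G (- S)) + sum f inner"
    by (rule sum.union_disjoint; auto simp: cut_arcs_def inner_def)+
  ultimately have out: "(\<Sum>v\<in>S. sum f (out_arcs G v)) = sum f (cut_arcs G S) + sum f inner"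
    and into: "(\<Sum>v\<in>S. sum f (in_arcs G v)) = sum f (cut_arcs G (- S)) + sum f inner"
    by simp_all
  have "v \<in> verts G - {s, t}" if "v \<in> S - {s}" for v
    using that S by auto
  then have "(\<Sum>v\<in>S - {s}. sum f (out_arcs G v) - sum f (in_arcs G v)) = 0"
    using flow by (intro sum.neutral) (simp add: is_flow_def)
  then have "flow_value G s f = (\<Sum>v\<in>S. sum f (out_arcs G v) - sum f (in_arcs G v))"
    using S \<open>finite S\<close> by (simp add: flow_value_def sum.remove[of S s])
  then show ?thesis
    by (simp add: sum_subtractf out into)
qed

lemma flow_value_le_cut_size:
  assumes flow: "is_flow G s t f" and cut: "S \<in> st_cuts G s t"
  shows "flow_value G s f \<le> real (cut_size G S)"
proof -
  have "sum f (cut_arcs G S) \<le> (\<Sum>e\<in>cut_arcs G S. 1)"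
    using flow by (intro sum_mono) (simp add: is_flow_def cut_arcs_def)
  moreover have "0 \<le> sum f (cut_arcs G (- S))"
    using flow by (intro sum_nonneg) (simp add: is_flow_def cut_arcs_def)
  ultimately show ?thesis
    using flow_value_eq_net_cut_flow[OF assms] by (simp add: cut_size_eq_card_cut_arcs)
qed

lemma arc_set_balance_UN:
  assumes "finite I" "disjoint_family_on A I"
  shows "arc_set_balance v (\<Union>i\<in>I. A i) = (\<Sum>i\<in>I. arc_set_balance v (A i))"
proof -
  have card_Int_UN: "card (B \<inter> (\<Union>i\<in>I. A i)) = (\<Sum>i\<in>I. card (B \<inter> A i))" if "finite B" for B
    unfolding Int_UN_distrib using assms that
    by (intro card_UN_disjoint) (auto simp: disjoint_family_on_def)
  show ?thesis
    by (simp add: arc_set_balance_def card_Int_UN finite_in_arcs finite_out_arcs sum_subtractf)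
qed

lemma arc_disjoint_trails_flow:
  assumes trails: "arc_disjoint_trails s I P t" and "s \<noteq> t"
  obtains f where "is_flow G s t f" "flow_value G s f = real (card I)"
proof -
  define U where "U = (\<Union>i\<in>I. set (P i))"
  define f :: "'b \<Rightarrow> real" where "f = (\<lambda>e. of_bool (e \<in> U))"
  have balance_U: "arc_set_balance v U = (\<Sum>i\<in>I. arc_set_balance v (set (P i)))" for v
    using trails unfolding U_def arc_disjoint_trails_def by (intro arc_set_balance_UN) auto
  have balanced: "arc_set_balanced s (set (P i)) t" if "i \<in> I" for i
    using trails that by (intro arc_balancedI_trail) (simp add: arc_disjoint_trails_def)
  have excess: "sum f (in_arcs G v) - sum f (out_arcs G v) = of_int (arc_set_balance v U)" for v
    by (simp add: f_def arc_set_balance_def sum_of_bool_eq finite_in_arcs finite_out_arcs)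
  have "arc_set_balance v U = 0" if "v \<in> verts G - {s, t}" for v
    unfolding balance_U using balanced that \<open>s \<noteq> t\<close>
    by (intro sum.neutral) (simp add: arc_set_balanced_def)
  then have "sum f (in_arcs G v) = sum f (out_arcs G v)" if "v \<in> verts G - {s, t}" for v
    using excess[of v] that by simp
  moreover have "0 \<le> f e \<and> f e \<le> 1" for e
    by (simp add: f_def)
  ultimately have "is_flow G s t f"
    by (simp add: is_flow_def)
  moreover have "arc_set_balance s U = (\<Sum>i\<in>I. -1)"
    unfolding balance_U using balanced \<open>s \<noteq> t\<close>
    by (intro sum.cong) (simp_all add: arc_set_balanced_def)
  then have "flow_value G s f = real (card I)"
    using excess[of s] by (simp add: flow_value_def)
  ultimately show ?thesis by (rule that)
qed

lemma card_arc_disjoint_trails_le_min_cut_size: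
  assumes trails: "arc_disjoint_trails s I P t" and "s \<noteq> t"
  shows "card I \<le> min_cut_size G s t"
proof (cases "I = {}")
  case False
  then have "s \<in> verts G"
    using trails by (auto simp: arc_disjoint_trails_def trail_def)
  obtain f where "is_flow G s t f" "flow_value G s f = real (card I)"
    using arc_disjoint_trails_flow assms by blast
  then have "card I \<le> cut_size G S" if "S \<in> st_cuts G s t" for S
    using flow_value_le_cut_size[OF _ that] by fastforce
  then show ?thesis
    by (rule min_cut_size_ge[OF \<open>s \<in> verts G\<close> \<open>s \<noteq> t\<close>])
qed simp

lemma card_arc_disjoint_trails_le_min_cut_size_delete_arcs:
  assumes trails: "arc_disjoint_trails s I P t" and "s \<noteq> t"
    and avoid: "\<And>i. i \<in> I \<Longrightarrow> set (P i) \<inter> F = {}"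
  shows "card I \<le> min_cut_size (delete_arcs G F) s t"
  using fin_digraph_delete_arcs
proof (rule fin_digraph.card_arc_disjoint_trails_le_min_cut_size)
  show "pre_digraph.arc_disjoint_trails (delete_arcs G F) s I P t"
    using trails avoid by (simp add: pre_digraph.arc_disjoint_trails_def trail_delete_arcs_iff)
qed fact

lemma has_max_flow_value_of_trails_and_cut:
  assumes trails: "arc_disjoint_trails s I P t"
    and cut: "S \<in> st_cuts G s t" "cut_size G S \<le> card I"
  shows "has_max_flow_value G s t (real (card I))"
proof -
  have "s \<noteq> t"
    using cut by (auto simp: st_cuts_def)
  then obtain f where "is_flow G s t f" "flow_value G s f = real (card I)"
    using arc_disjoint_trails_flow trails by blast
  moreover have "flow_value G s g \<le> real (card I)" if "is_flow G s t g" for g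
    using flow_value_le_cut_size[OF that cut(1)] cut(2) by linarith
  ultimately show ?thesis
    by (auto simp: has_max_flow_value_def is_max_flow_def)
qed

end

section \<open>Oracle space\<close>

lemma card_bool_lists_length_less: "card {D :: bool list. length D < b} < 2 ^ b"
proof (cases b)
  case (Suc m)
  have "card {D :: bool list. length D < b} = (\<Sum>i\<le>m. 2 ^ i)"
    using card_lists_length_le[of "UNIV :: bool set" m] by (simp add: Suc less_Suc_eq_le)
  also have "\<dots> < 2 ^ Suc m"
    by (induction m) auto
  finally show ?thesis by (simp add: Suc)
qed simp

lemma inj_on_imp_ex_length_ge:
  fixes f :: "'i \<Rightarrow> bool list"
  assumes "inj_on f X" "2 ^ b \<le> card X"
  shows "\<exists>x\<in>X. b \<le> length (f x)"
proof (rule ccontr)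
  assume "\<not> ?thesis"
  then have "f ` X \<subseteq> {D. length D < b}"
    by force
  moreover have "finite {D :: bool list. length D < b}"
    by (rule finite_subset[OF _ finite_lists_length_le[of UNIV b]]) auto
  ultimately have "card X \<le> card {D :: bool list. length D < b}"
    using assms(1) by (metis card_image card_mono)
  then show False
    using card_bool_lists_length_less[of b] assms(2) by simp
qed

lemma oracle_space_lower_bound:
  fixes G :: "'i \<Rightarrow> ('a, 'b) pre_digraph"
  assumes card: "2 ^ b \<le> card X"
    and distinguish: "\<And>x y. x \<in> X \<Longrightarrow> y \<in> X \<Longrightarrow> x \<noteq> y \<Longrightarrow>
      \<exists>F. F \<subseteq> arcs (G x) \<and> F \<subseteq> arcs (G y) \<and> card F = 2 \<and>
        min_cut_size (delete_arcs (G x) F) (s x) (t x) \<noteq>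
        min_cut_size (delete_arcs (G y) F) (s y) (t y)"
  shows "\<exists>x\<in>X. \<forall>D. dual_ft_min_cut_oracle query D (G x) (s x) (t x) \<longrightarrow> b \<le> length D"
proof (rule ccontr)
  assume "\<not> ?thesis"
  then obtain D where correct: "\<And>x. x \<in> X \<Longrightarrow> dual_ft_min_cut_oracle query (D x) (G x) (s x) (t x)"
    and short: "\<And>x. x \<in> X \<Longrightarrow> length (D x) < b"
    by (metis not_le)
  have "inj_on D X"
  proof (rule inj_onI, rule ccontr)
    fix x y assume "x \<in> X" "y \<in> X" "D x = D y" "x \<noteq> y"
    then show False
      using distinguish[of x y] correct[of x] correct[of y]
      unfolding dual_ft_min_cut_oracle_def by metis
  qed
  then show False
    using inj_on_imp_ex_length_ge[OF _ card] short by (metis not_le)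
qed

definition oracle_space_required :: "(bool list \<Rightarrow> edge set \<Rightarrow> nat) \<Rightarrow> nat \<Rightarrow> nat \<Rightarrow> nat \<Rightarrow> bool" where
  "oracle_space_required query n r b \<longleftrightarrow>
     (\<exists>(G :: (nat, edge) pre_digraph) s t.
        n_vertex_digraph n G \<and> s \<in> verts G \<and> t \<in> verts G \<and> s \<noteq> t \<and>
        has_max_flow_value G s t (2 * real r) \<and>
        (\<forall>D. dual_ft_min_cut_oracle query D G s t \<longrightarrow> b \<le> length D))"

definition edge_digraph :: "nat \<Rightarrow> edge set \<Rightarrow> (nat, edge) pre_digraph" where
  "edge_digraph n A = \<lparr>verts = {..<n}, arcs = A, tail = fst, head = fst \<circ> snd\<rparr>"

lemma edge_digraph_simps [simp]:
  "verts (edge_digraph n A) = {..<n}"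
  "arcs (edge_digraph n A) = A"
  "tail (edge_digraph n A) (u, v, k) = u"
  "head (edge_digraph n A) (u, v, k) = v"
  by (simp_all add: edge_digraph_def)

lemma n_vertex_digraph_edge_digraph:
  assumes "finite A" "\<And>u v k. (u, v, k) \<in> A \<Longrightarrow> u < n \<and> v < n"
  shows "n_vertex_digraph n (edge_digraph n A)"
proof -
  have "fin_digraph (edge_digraph n A)"
    using assms by unfold_locales auto
  then show ?thesis
    by (simp add: n_vertex_digraph_def)
qed

section \<open>The chain network\<close>

locale chain_network =
  fixes n r p L :: nat
  assumes p_pos: "0 < p" and p_le: "p \<le> r" and room: "2 + 2 * p * L \<le> n"
begin

text \<open>
  The source is \<open>0\<close> and the sink is \<open>1\<close>. The label of an arc is the number of its chain, for a cross
  arc that of the left chain, so arcs of different chains are distinct even if they are parallel.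
\<close>

definition levels :: "nat \<Rightarrow> nat" where
  "levels c = (if c < 2 * p then L else 0)"

definition node :: "nat \<Rightarrow> nat \<Rightarrow> nat" where
  "node c k = (if k = 0 then 0 else if k \<le> levels c then 2 + (2 * p * (k - 1) + c) else 1)"

definition chain_arc :: "nat \<Rightarrow> nat \<Rightarrow> edge" where
  "chain_arc c k = (node c k, node c (Suc k), c)"

definition chain :: "nat \<Rightarrow> edge list" where
  "chain c = map (chain_arc c) [0..<Suc (levels c)]"

definition positions :: "(nat \<times> nat \<times> nat) set" where
  "positions = {..<p} \<times> {p..<2 * p} \<times> {1..L}"

definition cross_arc :: "nat \<times> nat \<times> nat \<Rightarrow> edge" where
  "cross_arc = (\<lambda>(c, d, k). (node c k, node d k, c))"

definition network :: "(nat \<times> nat \<times> nat) set \<Rightarrow> (nat, edge) pre_digraph" where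
  "network X = edge_digraph n ((\<Union>c<2 * r. set (chain c)) \<union> cross_arc ` X)"

definition failure :: "nat \<times> nat \<times> nat \<Rightarrow> edge set" where
  "failure = (\<lambda>(c, d, k). {chain_arc c k, chain_arc d (k - 1)})"

subsection \<open>Vertices and arcs\<close>

lemma set_chain: "set (chain c) = chain_arc c ` {..levels c}"
  by (simp add: chain_def atLeast0LessThan lessThan_Suc_atMost del: upt_Suc)

lemma network_simps [simp]:
  "verts (network X) = {..<n}"
  "tail (network X) (u, v, l) = u"
  "head (network X) (u, v, l) = v"
  by (simp_all add: network_def)

lemma arcs_network: "arcs (network X) = (\<Union>c<2 * r. chain_arc c ` {..levels c}) \<union> cross_arc ` X"
  by (simp add: network_def set_chain)

lemma chain_arc_in_arcs: "c < 2 * r \<Longrightarrow> k \<le> levels c \<Longrightarrow> chain_arc c k \<in> arcs (network X)"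
  unfolding arcs_network by blast

lemma finite_positions: "finite positions" and card_positions: "card positions = p * p * L"
  by (auto simp: positions_def)

lemma positionsD:
  assumes "(c, d, k) \<in> positions"
  shows "c < p" "p \<le> d" "d < 2 * p" "1 \<le> k" "k \<le> L" "c \<noteq> d" "c < 2 * r" "d < 2 * r"
    and "levels c = L" "levels d = L"
  using assms p_le by (auto simp: positions_def levels_def)

lemma node_0 [simp]: "node c 0 = 0"
  by (simp add: node_def)

lemma node_end [simp]: "levels c < k \<Longrightarrow> node c k = 1"
  by (simp add: node_def)

lemma node_eq_0_iff [simp]: "node c k = 0 \<longleftrightarrow> k = 0"
  by (simp add: node_def)

lemma le_levelsD: "1 \<le> k \<Longrightarrow> k \<le> levels c \<Longrightarrow> c < 2 * p \<and> k \<le> L"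
  by (auto simp: levels_def split: if_splits)

lemma node_inject:
  assumes "node c k = node d j" "1 \<le> k" "k \<le> levels c"
  shows "c = d \<and> k = j"
proof -
  have j: "1 \<le> j" "j \<le> levels d"
    using assms by (auto simp: node_def split: if_splits)
  have chains: "c < 2 * p" "d < 2 * p"
    using le_levelsD assms j by blast+
  have number: "2 * p * (k - 1) + c = 2 * p * (j - 1) + d"
    using assms j by (auto simp: node_def)
  have "c = d"
    using arg_cong[OF number, of "\<lambda>m. m mod (2 * p)"] chains by simp
  moreover have "k - 1 = j - 1"
    using arg_cong[OF number, of "\<lambda>m. m div (2 * p)"] chains p_pos by simp
  ultimately show ?thesis using assms j by simp
qed

lemma node_less: "node c k < n"
proof (cases "1 \<le> k \<and> k \<le> levels c")
  case True
  then have "c < 2 * p" "k \<le> L"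
    using le_levelsD by blast+
  then have "2 * p * (k - 1) + c < 2 * p * k"
    using True by (cases k) simp_all
  also have "\<dots> \<le> 2 * p * L"
    using \<open>k \<le> L\<close> by simp
  finally show ?thesis
    using True room by (simp add: node_def)
next
  case False
  then show ?thesis using room by (auto simp: node_def)
qed

lemma chain_arc_eq_iff:
  assumes "i \<le> levels c" "j \<le> levels d"
  shows "chain_arc c i = chain_arc d j \<longleftrightarrow> c = d \<and> i = j"
proof
  assume eq: "chain_arc c i = chain_arc d j"
  show "c = d \<and> i = j"
  proof (cases "i = 0")
    case True
    then have "node d j = 0"
      using eq by (simp add: chain_arc_def)
    then show ?thesis
      using eq True by (simp add: chain_arc_def)
  next
    case False
    then show ?thesis
      using eq assms(1) by (auto simp: chain_arc_def dest: node_inject)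
  qed
qed simp

lemma distinct_chain_segment: "j \<le> Suc (levels c) \<Longrightarrow> distinct (map (chain_arc c) [i..<j])"
  by (auto simp: distinct_map inj_on_def chain_arc_eq_iff)

lemma chain_arcs_disjoint: "c \<noteq> d \<Longrightarrow> chain_arc c ` A \<inter> chain_arc d ` B = {}"
  by (auto simp: chain_arc_def)

lemma cross_arc_notin_chain_arcs:
  assumes "(c, d, k) \<in> positions"
  shows "cross_arc (c, d, k) \<notin> chain_arc e ` A"
proof
  assume "cross_arc (c, d, k) \<in> chain_arc e ` A"
  then obtain i where "node d k = node c (Suc i)"
    by (auto simp: chain_arc_def cross_arc_def)
  then show False
    using node_inject[of d k c "Suc i"] positionsD[OF assms] by auto
qed

lemma failure_subset_arcs:
  assumes "q \<in> positions"
  shows "failure q \<subseteq> arcs (network X)"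
proof -
  obtain c d k where q: "q = (c, d, k)" by (cases q)
  then show ?thesis
    using positionsD[of c d k] assms by (auto simp: failure_def intro!: chain_arc_in_arcs)
qed

lemma card_failure:
  assumes "q \<in> positions"
  shows "card (failure q) = 2"
  using assms by (auto simp: failure_def positions_def chain_arc_def)

lemma n_vertex_digraph_network:
  assumes "X \<subseteq> positions"
  shows "n_vertex_digraph n (network X)"
  unfolding network_def
proof (rule n_vertex_digraph_edge_digraph)
  show "finite ((\<Union>c<2 * r. set (chain c)) \<union> cross_arc ` X)"
    using finite_subset[OF assms finite_positions] by simp
qed (auto simp: set_chain chain_arc_def cross_arc_def node_less)

lemma fin_digraph_network: "X \<subseteq> positions \<Longrightarrow> fin_digraph (network X)"
  using n_vertex_digraph_network by (simp add: n_vertex_digraph_def)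

subsection \<open>Trails\<close>

lemma awalk_chain_segment:
  assumes "X \<subseteq> positions" "c < 2 * r" "i \<le> j" "j \<le> Suc (levels c)"
  shows "pre_digraph.awalk (network X) (node c i) (map (chain_arc c) [i..<j]) (node c j)"
proof -
  interpret fin_digraph "network X"
    using assms(1) by (rule fin_digraph_network)
  have "chain_arc c l \<in> arcs (network X)" if "l < j" for l
    using that assms by (intro chain_arc_in_arcs) simp_all
  then show ?thesis
    using assms by (intro awalk_map_upt) (simp_all add: chain_arc_def node_less)
qed

lemma trail_chain:
  assumes "X \<subseteq> positions" "c < 2 * r"
  shows "pre_digraph.trail (network X) 0 (chain c) 1"
proof -
  have "distinct (chain c)"
    by (simp add: chain_def distinct_chain_segment del: upt_Suc)
  then show ?thesis
    using awalk_chain_segment[OF assms, of 0 "Suc (levels c)"]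
    by (simp add: pre_digraph.trail_def chain_def)
qed

lemma disjoint_family_on_chain: "disjoint_family_on (\<lambda>c. set (chain c)) I"
  by (simp add: disjoint_family_on_def set_chain chain_arcs_disjoint)

lemma has_max_flow_value_network:
  assumes "X \<subseteq> positions"
  shows "has_max_flow_value (network X) 0 1 (2 * real r)"
proof -
  interpret fin_digraph "network X"
    using assms by (rule fin_digraph_network)
  have "arc_disjoint_trails 0 {..<2 * r} chain 1"
    using trail_chain[OF assms] disjoint_family_on_chain by (simp add: arc_disjoint_trails_def)
  moreover have "{0} \<in> st_cuts (network X) 0 1"
    using room by (simp add: st_cuts_def)
  moreover have "cut_arcs (network X) {0} \<subseteq> (\<lambda>c. chain_arc c 0) ` {..<2 * r}"
    using assms
    by (auto simp: cut_arcs_def arcs_network chain_arc_def cross_arc_def positions_def)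
  then have "cut_size (network X) {0} \<le> card {..<2 * r}"
    unfolding cut_size_eq_card_cut_arcs by (rule surj_card_le[OF finite_lessThan])
  ultimately show ?thesis
    using has_max_flow_value_of_trails_and_cut by fastforce
qed

definition detour :: "nat \<times> nat \<times> nat \<Rightarrow> edge list" where
  "detour = (\<lambda>(c, d, k).
     map (chain_arc c) [0..<k] @ cross_arc (c, d, k) # map (chain_arc d) [k..<Suc (levels d)])"

lemma trail_detour:
  assumes X: "X \<subseteq> positions" and q: "(c, d, k) \<in> X"
  shows "pre_digraph.trail (network X) 0 (detour (c, d, k)) 1"
proof -
  interpret fin_digraph "network X"
    using X by (rule fin_digraph_network)
  have pos: "(c, d, k) \<in> positions" using assms by blast
  then have "c \<noteq> d" by (rule positionsD)
  note bounds = positionsD[OF pos]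
  have before: "awalk 0 (map (chain_arc c) [0..<k]) (node c k)"
    using awalk_chain_segment[OF X, of c 0 k] bounds by simp
  have "cross_arc (c, d, k) \<in> arcs (network X)"
    using q by (simp add: arcs_network)
  then have across: "awalk (node c k) [cross_arc (c, d, k)] (node d k)"
    using arc_implies_awalk[of "cross_arc (c, d, k)"] by (simp add: cross_arc_def)
  have after: "awalk (node d k) (map (chain_arc d) [k..<Suc (levels d)]) 1"
    using awalk_chain_segment[OF X, of d k "Suc (levels d)"] bounds by simp
  have "awalk 0 (detour (c, d, k)) 1"
    using awalk_appendI[OF before awalk_appendI[OF across after]] by (simp add: detour_def)
  moreover have "distinct (detour (c, d, k))"
    using bounds distinct_chain_segment[of k c 0] distinct_chain_segment[of "Suc (levels d)" d k]
      cross_arc_notin_chain_arcs[OF pos] chain_arcs_disjoint[OF \<open>c \<noteq> d\<close>]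
    by (simp add: detour_def del: upt_Suc)
  ultimately show ?thesis by (simp add: trail_def)
qed

lemma detour_Int_failure:
  assumes "(c, d, k) \<in> positions"
  shows "set (detour (c, d, k)) \<inter> failure (c, d, k) = {}"
proof -
  have "chain_arc e i \<noteq> cross_arc (c, d, k)" for e i
    using cross_arc_notin_chain_arcs[OF assms, of e "{i}"] by auto
  then show ?thesis
    using positionsD[OF assms]
    by (auto simp: detour_def failure_def chain_arc_eq_iff simp del: upt_Suc)
qed

lemma chain_Int_failure: "e \<notin> {c, d} \<Longrightarrow> set (chain e) \<inter> failure (c, d, k) = {}"
  by (auto simp: set_chain failure_def chain_arc_def)

lemma min_cut_size_failure_ge:
  assumes X: "X \<subseteq> positions" and q: "(c, d, k) \<in> X"
  shows "2 * r - 1 \<le> min_cut_size (delete_arcs (network X) (failure (c, d, k))) 0 1"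
proof -
  interpret fin_digraph "network X"
    using X by (rule fin_digraph_network)
  have pos: "(c, d, k) \<in> positions" using X q by blast
  define P where "P e = (if e = c then detour (c, d, k) else chain e)" for e
  have "disjoint_family_on (\<lambda>e. set (P e)) ({..<2 * r} - {d})"
    by (auto simp: disjoint_family_on_def P_def detour_def set_chain chain_arc_def cross_arc_def)
  then have "arc_disjoint_trails 0 ({..<2 * r} - {d}) P 1"
    using trail_chain[OF X] trail_detour[OF X q] by (simp add: arc_disjoint_trails_def P_def)
  moreover have "set (P e) \<inter> failure (c, d, k) = {}" if "e \<in> {..<2 * r} - {d}" for e
    using that detour_Int_failure[OF pos] chain_Int_failure by (simp add: P_def)
  ultimately have "card ({..<2 * r} - {d})
      \<le> min_cut_size (delete_arcs (network X) (failure (c, d, k))) 0 1"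
    by (rule card_arc_disjoint_trails_le_min_cut_size_delete_arcs[OF _ zero_neq_one])
  then show ?thesis
    using positionsD[OF pos] by simp
qed

subsection \<open>Cuts\<close>

text \<open>
  The right chains other than \<open>d\<close> lie on the source side, so that no cross arc into them is cut.
\<close>

definition upstream :: "nat \<times> nat \<times> nat \<Rightarrow> nat \<Rightarrow> nat \<Rightarrow> bool" where
  "upstream = (\<lambda>(c, d, k) e i. e = c \<and> i \<le> k \<or> e = d \<and> i < k \<or> p \<le> e \<and> e \<noteq> d)"

definition source_side :: "nat \<times> nat \<times> nat \<Rightarrow> nat set" where
  "source_side q = insert 0 {node e i |e i. 1 \<le> i \<and> i \<le> levels e \<and> upstream q e i}"

lemma node_in_source_side_iff:
  "node e i \<in> source_side q \<longleftrightarrow> i = 0 \<or> i \<le> levels e \<and> upstream q e i"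
proof
  assume "node e i \<in> source_side q"
  then consider "i = 0"
    | e' i' where "node e' i' = node e i" "1 \<le> i'" "i' \<le> levels e'" "upstream q e' i'"
    by (force simp: source_side_def)
  then show "i = 0 \<or> i \<le> levels e \<and> upstream q e i"
    using node_inject by cases blast+
next
  assume "i = 0 \<or> i \<le> levels e \<and> upstream q e i"
  then show "node e i \<in> source_side q"
    unfolding source_side_def by (cases "i = 0") (simp, force)
qed

lemma source_side_in_st_cuts: "source_side q \<in> st_cuts (network X) 0 1"
proof -
  have "1 \<notin> source_side q"
    using node_in_source_side_iff[of 0 "Suc (levels 0)" q] by simp
  then show ?thesis
    using room by (auto simp: st_cuts_def source_side_def node_less)
qed

definition exit_arc :: "nat \<Rightarrow> edge" where
  "exit_arc e = chain_arc e (if p \<le> e then levels e else 0)"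

lemma chain_arc_leaving_source_side:
  assumes q: "(c, d, k) \<in> positions" and i: "i \<le> levels e"
    and leaves: "node e i \<in> source_side (c, d, k)" "node e (Suc i) \<notin> source_side (c, d, k)"
    and intact: "chain_arc e i \<notin> failure (c, d, k)"
  shows "e \<notin> {c, d} \<and> chain_arc e i = exit_arc e"
proof -
  have "e = c \<Longrightarrow> i \<noteq> k" "e = d \<Longrightarrow> i \<noteq> k - 1"
    using intact by (auto simp: failure_def)
  then have "e \<notin> {c, d} \<and> i = (if p \<le> e then levels e else 0)"
    using leaves i positionsD[OF q] by (auto simp: node_in_source_side_iff upstream_def)
  then show ?thesis
    by (simp add: exit_arc_def)
qed

lemma cross_arc_leaving_source_side:
  assumes "(c, d, k) \<in> positions" "(c', d', k') \<in> positions"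
    and "node c' k' \<in> source_side (c, d, k)" "node d' k' \<notin> source_side (c, d, k)"
  shows "(c', d', k') = (c, d, k)"
  using assms positionsD[OF assms(1)] positionsD[OF assms(2)]
  by (auto simp: node_in_source_side_iff upstream_def)

lemma cut_arcs_source_side:
  assumes X: "X \<subseteq> positions" and q: "(c, d, k) \<in> positions" "(c, d, k) \<notin> X"
  shows "cut_arcs (network X) (source_side (c, d, k)) - failure (c, d, k)
    \<subseteq> exit_arc ` ({..<2 * r} - {c, d})"
proof
  fix a assume a: "a \<in> cut_arcs (network X) (source_side (c, d, k)) - failure (c, d, k)"
  then consider (chain) e i where "a = chain_arc e i" "e < 2 * r" "i \<le> levels e"
    | (cross) c' d' k' where "a = cross_arc (c', d', k')" "(c', d', k') \<in> X"
    by (auto simp: cut_arcs_def arcs_network)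
  then show "a \<in> exit_arc ` ({..<2 * r} - {c, d})"
  proof cases
    case chain
    then have "e \<notin> {c, d} \<and> chain_arc e i = exit_arc e"
      using a by (intro chain_arc_leaving_source_side[OF q(1)])
        (auto simp: cut_arcs_def chain_arc_def)
    then show ?thesis using chain by auto
  next
    case cross
    then have "(c', d', k') = (c, d, k)"
      using a X by (intro cross_arc_leaving_source_side[OF q(1)])
        (auto simp: cut_arcs_def cross_arc_def)
    then show ?thesis using cross q(2) by simp
  qed
qed

lemma min_cut_size_failure_le:
  assumes X: "X \<subseteq> positions" and q: "(c, d, k) \<in> positions" "(c, d, k) \<notin> X"
  shows "min_cut_size (delete_arcs (network X) (failure (c, d, k))) 0 1 \<le> 2 * r - 2"
proof -
  let ?G = "delete_arcs (network X) (failure (c, d, k))"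
  interpret fin_digraph ?G
    using fin_digraph_network[OF X] by (rule fin_digraph.fin_digraph_delete_arcs)
  have "min_cut_size ?G 0 1 \<le> cut_size ?G (source_side (c, d, k))"
    by (rule min_cut_size_le) (simp add: source_side_in_st_cuts del: One_nat_def)
  also have "\<dots> \<le> card ({..<2 * r} - {c, d})"
    unfolding cut_size_eq_card_cut_arcs cut_arcs_delete_arcs
    using cut_arcs_source_side[OF X q] by (intro surj_card_le) simp_all
  also have "\<dots> = 2 * r - 2"
    using positionsD[OF q(1)] by (simp add: card_Diff_subset)
  finally show ?thesis .
qed

lemma min_cut_size_failure_ge_iff:
  assumes "X \<subseteq> positions" "q \<in> positions"
  shows "2 * r - 1 \<le> min_cut_size (delete_arcs (network X) (failure q)) 0 1 \<longleftrightarrow> q \<in> X"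
proof -
  obtain c d k where q: "q = (c, d, k)" by (cases q)
  show ?thesis
    using min_cut_size_failure_ge[of X c d k] min_cut_size_failure_le[of X c d k] assms p_pos p_le
    unfolding q by (cases "(c, d, k) \<in> X") auto
qed

lemma network_oracle_space:
  "\<exists>X\<in>Pow positions. \<forall>D. dual_ft_min_cut_oracle query D (network X) 0 1 \<longrightarrow> p * p * L \<le> length D"
proof (rule oracle_space_lower_bound)
  show "2 ^ (p * p * L) \<le> card (Pow positions)"
    by (simp add: card_Pow finite_positions card_positions)
next
  fix X Y assume XY: "X \<in> Pow positions" "Y \<in> Pow positions" "X \<noteq> Y"
  then obtain q where q: "q \<in> positions" "q \<in> X \<longleftrightarrow> q \<notin> Y" by blast
  then have "min_cut_size (delete_arcs (network X) (failure q)) 0 1 \<noteq>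
      min_cut_size (delete_arcs (network Y) (failure q)) 0 1"
    using min_cut_size_failure_ge_iff[of X q] min_cut_size_failure_ge_iff[of Y q] XY by auto
  then show "\<exists>F. F \<subseteq> arcs (network X) \<and> F \<subseteq> arcs (network Y) \<and> card F = 2 \<and>
      min_cut_size (delete_arcs (network X) F) 0 1 \<noteq> min_cut_size (delete_arcs (network Y) F) 0 1"
    using failure_subset_arcs[OF q(1)] card_failure[OF q(1)] by blast
qed

lemma oracle_space_required_chain_network: "oracle_space_required query n r (p * p * L)"
proof -
  obtain X where X: "X \<subseteq> positions"
    and "\<forall>D. dual_ft_min_cut_oracle query D (network X) 0 1 \<longrightarrow> p * p * L \<le> length D"
    using network_oracle_space by blast
  moreover have "0 \<in> verts (network X)" "1 \<in> verts (network X)"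
    using room by auto
  ultimately show ?thesis
    unfolding oracle_space_required_def
    using n_vertex_digraph_network[OF X] has_max_flow_value_network[OF X] zero_neq_one by blast
qed

end

lemma chain_network_parameters:
  fixes n r :: nat
  assumes "4 \<le> n" "1 \<le> r" "r \<le> n"
  obtains p L where "chain_network n r p L" "n * r \<le> 50 * (p * p * L)"
proof -
  define N where "N = (n - 2) div 2"
  define p where "p = min r N"
  define L where "L = N div p"
  have N_bounds: "1 \<le> N" "n \<le> 5 * N" "2 + 2 * N \<le> n"
    using assms(1) unfolding N_def by presburger+
  have p_bounds: "0 < p" "p \<le> r" "p \<le> N" "r \<le> 5 * p"
    using N_bounds assms by (auto simp: p_def)
  have L_bounds: "0 < L" "p * L \<le> N"
    using p_bounds by (auto simp: L_def div_greater_zero_iff)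
  have "N = p * L + N mod p"
    by (simp add: L_def)
  moreover have "N mod p < p" "p \<le> p * L"
    using p_bounds L_bounds by simp_all
  ultimately have half: "N \<le> 2 * (p * L)" by linarith
  have "n * r \<le> (5 * N) * (5 * p)"
    using N_bounds p_bounds by (intro mult_mono) auto
  also have "\<dots> \<le> (5 * (2 * (p * L))) * (5 * p)"
    using half by (intro mult_mono) auto
  finally have "n * r \<le> 50 * (p * p * L)"
    by (simp add: algebra_simps)
  moreover have "chain_network n r p L"
    using p_bounds L_bounds N_bounds by unfold_locales (auto simp: mult.assoc)
  ultimately show ?thesis using that by blast
qed

section \<open>A single bit\<close>

text \<open>
  The chain network needs four vertices. For fewer, a single bit is enough: the query is not told
  which of \<open>0\<close> and \<open>1\<close> is the source, so it cannot know whether failing arcs from \<open>0\<close> to \<open>1\<close> matter.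
\<close>

definition antiparallel_digraph :: "nat \<Rightarrow> nat \<Rightarrow> nat \<Rightarrow> nat \<Rightarrow> (nat, edge) pre_digraph" where
  "antiparallel_digraph n m s t = edge_digraph n ({s} \<times> {t} \<times> {..<m} \<union> {t} \<times> {s} \<times> {..<m})"

lemma antiparallel_digraph_commute: "antiparallel_digraph n m s t = antiparallel_digraph n m t s"
  by (simp add: antiparallel_digraph_def Un_commute)

lemma n_vertex_digraph_antiparallel_digraph:
  "s < n \<Longrightarrow> t < n \<Longrightarrow> n_vertex_digraph n (antiparallel_digraph n m s t)"
  unfolding antiparallel_digraph_def by (rule n_vertex_digraph_edge_digraph) auto

locale antiparallel_pair =
  fixes n m s t :: nat
  assumes s_less: "s < n" and t_less: "t < n" and s_neq_t: "s \<noteq> t"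
begin

abbreviation G :: "(nat, edge) pre_digraph" where
  "G \<equiv> antiparallel_digraph n m s t"

sublocale fin_digraph G
  using n_vertex_digraph_antiparallel_digraph[OF s_less t_less] by (simp add: n_vertex_digraph_def)

lemma cut_arcs_source: "cut_arcs G {s} = {s} \<times> {t} \<times> {..<m}"
  using s_neq_t by (auto simp: cut_arcs_def antiparallel_digraph_def)

lemma source_in_st_cuts: "{s} \<in> st_cuts G s t"
  using s_less s_neq_t by (simp add: st_cuts_def antiparallel_digraph_def)

lemma arc_disjoint_trails_single_arcs: "arc_disjoint_trails s {..<m} (\<lambda>i. [(s, t, i)]) t"
  using t_less
  by (auto simp: arc_disjoint_trails_def trail_simps disjoint_family_on_def)
    (auto simp: antiparallel_digraph_def)

lemma has_max_flow_value: "has_max_flow_value G s t (real m)"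
  using has_max_flow_value_of_trails_and_cut[OF arc_disjoint_trails_single_arcs source_in_st_cuts]
  by (simp add: cut_size_eq_card_cut_arcs cut_arcs_source card_cartesian_product)

lemma min_cut_size_forward_failure_less:
  assumes "F \<subseteq> {s} \<times> {t} \<times> {..<m}" "F \<noteq> {}"
  shows "min_cut_size (delete_arcs G F) s t < m"
proof -
  interpret deleted: fin_digraph "delete_arcs G F"
    by (rule fin_digraph_delete_arcs)
  have "min_cut_size (delete_arcs G F) s t \<le> cut_size (delete_arcs G F) {s}"
    by (rule deleted.min_cut_size_le) (simp add: source_in_st_cuts)
  also have "\<dots> = card ({s} \<times> {t} \<times> {..<m} - F)"
    by (simp add: cut_size_eq_card_cut_arcs cut_arcs_delete_arcs cut_arcs_source)
  also have "\<dots> < card ({s} \<times> {t} \<times> {..<m})"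
    using assms by (intro psubset_card_mono) auto
  finally show ?thesis
    by (simp add: card_cartesian_product)
qed

lemma min_cut_size_backward_failure_ge:
  assumes "F \<subseteq> {t} \<times> {s} \<times> {..<m}"
  shows "m \<le> min_cut_size (delete_arcs G F) s t"
proof -
  have "set [(s, t, i)] \<inter> F = {}" for i
    using assms s_neq_t by auto
  then have "card {..<m} \<le> min_cut_size (delete_arcs G F) s t"
    by (rule card_arc_disjoint_trails_le_min_cut_size_delete_arcs[OF
          arc_disjoint_trails_single_arcs s_neq_t])
  then show ?thesis by simp
qed

end

lemma oracle_space_required_one:
  assumes "2 \<le> n" "1 \<le> r"
  shows "oracle_space_required query n r 1"
proof -
  let ?G = "antiparallel_digraph n (2 * r) 0 1"
  interpret forward: antiparallel_pair n "2 * r" 0 1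
    using assms by unfold_locales auto
  interpret backward: antiparallel_pair n "2 * r" 1 0
    using assms by unfold_locales auto
  have swap: "antiparallel_digraph n (2 * r) 1 0 = ?G"
    by (rule antiparallel_digraph_commute)
  define F :: "edge set" where "F = {0} \<times> {1} \<times> {0, 1}"
  have failing: "F \<subseteq> {0} \<times> {1} \<times> {..<2 * r}" "F \<noteq> {}" "card F = 2"
    using assms by (auto simp: F_def)
  then have "F \<subseteq> arcs ?G"
    by (auto simp: antiparallel_digraph_def)
  moreover have "min_cut_size (delete_arcs ?G F) 0 1 < 2 * r"
    using failing by (intro forward.min_cut_size_forward_failure_less)
  moreover have "2 * r \<le> min_cut_size (delete_arcs ?G F) 1 0"
    using backward.min_cut_size_backward_failure_ge[OF failing(1)] unfolding swap .
  ultimately have "\<exists>x\<in>{(0, 1), (1, 0)}.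
      \<forall>D. dual_ft_min_cut_oracle query D ?G (fst x) (snd x) \<longrightarrow> 1 \<le> length D"
    using failing(3) by (intro oracle_space_lower_bound) (auto intro!: exI[of _ F])
  moreover have "has_max_flow_value ?G 0 1 (2 * real r)" "has_max_flow_value ?G 1 0 (2 * real r)"
    using forward.has_max_flow_value backward.has_max_flow_value[unfolded swap] by simp_all
  moreover have "n_vertex_digraph n ?G" "{0, 1} \<subseteq> verts ?G"
    using assms n_vertex_digraph_antiparallel_digraph[of 0 n 1] by (auto simp: antiparallel_digraph_def)
  ultimately show ?thesis
    unfolding oracle_space_required_def by fastforce
qed

section \<open>The lower bound\<close>

lemma oracle_space_required_of_order:
  assumes "2 \<le> n" "1 \<le> r" "r \<le> n"
  obtains b where "n * r \<le> 50 * b" "oracle_space_required query n r b"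
proof (cases "4 \<le> n")
  case True
  then obtain p L where "chain_network n r p L" "n * r \<le> 50 * (p * p * L)"
    using chain_network_parameters assms by blast
  then show ?thesis
    using that chain_network.oracle_space_required_chain_network by blast
next
  case False
  then have "n * r \<le> 3 * 3"
    using assms by (intro mult_mono) auto
  then show ?thesis
    using that[of 1] oracle_space_required_one assms by simp
qed

theorem theorem14:
  shows "\<exists>c::real. c > 0 \<and>
    (\<forall>n r :: nat. 2 \<le> n \<and> 1 \<le> r \<and> r \<le> n \<longrightarrow>
      (\<forall>query :: bool list \<Rightarrow> edge set \<Rightarrow> nat.
        \<exists>(G :: (nat, edge) pre_digraph) s t.
          n_vertex_digraph n G \<and> s \<in> verts G \<and> t \<in> verts G \<and> s \<noteq> t \<and>
          has_max_flow_value G s t (2 * real r) \<and>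
          (\<forall>D. dual_ft_min_cut_oracle query D G s t \<longrightarrow>
             c * real n * real r \<le> real (length D))))"
proof (intro exI[of _ "1 / 50 :: real"] conjI allI impI)
  fix n r :: nat and query :: "bool list \<Rightarrow> edge set \<Rightarrow> nat"
  assume "2 \<le> n \<and> 1 \<le> r \<and> r \<le> n"
  then obtain b where large: "n * r \<le> 50 * b" and required: "oracle_space_required query n r b"
    using oracle_space_required_of_order by blast
  have "1 / 50 * real n * real r \<le> real l" if "b \<le> l" for l
  proof -
    have "real (n * r) \<le> real (50 * l)"
      using large that by (intro of_nat_mono) linarith
    then show ?thesis by simp
  qed
  then show "\<exists>G s t. n_vertex_digraph n G \<and> s \<in> verts G \<and> t \<in> verts G \<and> s \<noteq> t \<and>
      has_max_flow_value G s t (2 * real r) \<and>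
      (\<forall>D. dual_ft_min_cut_oracle query D G s t \<longrightarrow> 1 / 50 * real n * real r \<le> real (length D))"
    using required unfolding oracle_space_required_def by blast
qed simp

end
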